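(* For each $m\ge1$, let $(f_\mu)_{\mu\in\mathbb R^{p_m}}$ be a location family of densities on $\mathbb R^{p_m}$ and let $\|\cdot\|_{\mathbb R^{p_m}}$ be a norm on $\mathbb R^{p_m}$. Suppose $Z_{m,1},\dots,Z_{m,n_m}\sim f_{\mu_m}$ and $Y_{m,1},\dots,Y_{m,n_m'}\sim f_{\mu_m'}$ are all independent, and test the null hypothesis $\mu_m=\mu_m'$ against the alternative $\mu_m\ne\mu_m'$. Let $\Theta_{m1}\subset\mathbb R^{p_m}\times\mathbb R^{p_m}$. Consider the randomization test with test statistic $\|\bar Z_m-\bar Y_m\|_{\mathbb R^{p_m}}$, where $\bar Z_m=n_m^{-1}\sum_{i=1}^{n_m}Z_{m,i}$ and $\bar Y_m=(n_m')^{-1}\sum_{i=1}^{n_m'}Y_{m,i}$, and randomization distribution uniform over the symmetric group $S_{n_m+n_m'}$ of all permutations of the $n_m+n_m'$ observations. Suppose that: 1. as $m\to\infty$, $n_m+n_m'\to\infty$; 2. there is a sequence $(t_m)_{m\ge1}$ of positive numbers such that $P\big(\|(n_m')^{-1}\sum_{i=1}^{n_m'}\varepsilon_{m,i}'-n_m^{-1}\sum_{i=1}^{n_m}\varepsilon_{m,i}\|_{\mathbb R^{p_m}}\le t_m\big)\to1$, where $\varepsilon_{m,i},\varepsilon_{m,j}'\sim f_{0}$, $i\in\{1,\dots,n_m\}$, $j\in\{1,\dots,n_m'\}$, are iid; 3. for every sequence $(\mu_m,\mu_m')_{m\ge1}$ such that $(\mu_m,\mu_m')\in\Theta_{m1}$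 for all $m\ge 1$, $$\liminf_{m\to\infty}\frac{\|\mu_m'-\mu_m\|_{\mathbb R^{p_m}}}{t_m}>2.$$ Then the sequence of randomization tests of $\mu_m=\mu_m'$ is consistent against the sequence of alternatives with $(\mu_m,\mu_m')\in\Theta_{m1}$.
   Context: Location family: $f_\mu(x)=f_0(x-\mu)$, with $f_0$ the density at the zero vector $0\in\mathbb R^{p_m}$ (the family may depend on $m$). Sample sizes satisfy $n_m,n_m'\ge1$. Randomization test: the data is the list (or matrix with rows) $X_m=(Z_{m,1},\dots,Z_{m,n_m},Y_{m,1},\dots,Y_{m,n_m'})$, on which $S_{n_m+n_m'}$ acts by permuting the observations; $f_m(X_m)$ is the norm of the difference between the average of the first $n_m$ and the average of the last $n_m'$ observations. With a fixed level $\alpha\in(0,1]$ and a fixed integer $K\ge1$ with $1/(K+1)\le\alpha$, draw $G_{m1},\dots,G_{mK}$ iid uniform over $S_{n_m+n_m'}$, independently of the data; let $f_{(1)}\le\dots\le f_{(K+1)}$ be the ordered values of $f_m(X_m),f_m(G_{m1}X_m),\dots,f_m(G_{mK}X_m)$ and $k=\lceil(1-\alpha)(K+1)\rceil$; reject when $f_m(X_m)>f_{(k)}$ (with $f_{(0)}=-\infty$). Consistent means: for every sequence with $(\mu_m,\mu_m')\in\Theta_{m1}$ for all $m$, the rejection probability (over the data and the random permutations) tends to $1$ as $m\to\infty$. *)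

theory Defs
  imports "HOL-Probability.Probability" "HOL-Combinatorics.Combinatorics"
begin

text \<open>The dimension varies along the sequence of experiments, so $R^p$ is the carrier of the
  product measure over the coordinates \<open>{..<p}\<close> instead of a type. Its elements are
  \<^const>\<open>undefined\<close> outside \<open>{..<p}\<close>, hence the restrictions in the vector operations.\<close>

definition Rn :: "nat \<Rightarrow> (nat \<Rightarrow> real) set" where
  "Rn p = {..<p} \<rightarrow>\<^sub>E UNIV"

definition lborel_Rn :: "nat \<Rightarrow> (nat \<Rightarrow> real) measure" where
  "lborel_Rn p = Pi\<^sub>M {..<p} (\<lambda>_. lborel)"

definition vzero :: "nat \<Rightarrow> nat \<Rightarrow> real" where
  "vzero p = (\<lambda>j\<in>{..<p}. 0)"

definition vadd :: "nat \<Rightarrow> (nat \<Rightarrow> real) \<Rightarrow> (nat \<Rightarrow> real) \<Rightarrow> nat \<Rightarrow> real" where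
  "vadd p x y = (\<lambda>j\<in>{..<p}. x j + y j)"

definition vdiff :: "nat \<Rightarrow> (nat \<Rightarrow> real) \<Rightarrow> (nat \<Rightarrow> real) \<Rightarrow> nat \<Rightarrow> real" where
  "vdiff p x y = (\<lambda>j\<in>{..<p}. x j - y j)"

definition vscale :: "nat \<Rightarrow> real \<Rightarrow> (nat \<Rightarrow> real) \<Rightarrow> nat \<Rightarrow> real" where
  "vscale p c x = (\<lambda>j\<in>{..<p}. c * x j)"

definition is_norm :: "nat \<Rightarrow> ((nat \<Rightarrow> real) \<Rightarrow> real) \<Rightarrow> bool" where
  "is_norm p N \<longleftrightarrow>
     (\<forall>x\<in>Rn p. 0 \<le> N x \<and> (N x = 0 \<longleftrightarrow> x = vzero p)) \<and>
     (\<forall>x\<in>Rn p. \<forall>c. N (vscale p c x) = \<bar>c\<bar> * N x) \<and>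
     (\<forall>x\<in>Rn p. \<forall>y\<in>Rn p. N (vadd p x y) \<le> N x + N y)"

definition is_density :: "nat \<Rightarrow> ((nat \<Rightarrow> real) \<Rightarrow> real) \<Rightarrow> bool" where
  "is_density p h \<longleftrightarrow>
     h \<in> borel_measurable (lborel_Rn p) \<and> (\<forall>x\<in>Rn p. 0 \<le> h x) \<and>
     (\<integral>\<^sup>+x. ennreal (h x) \<partial>lborel_Rn p) = 1"

definition location_family :: "nat \<Rightarrow> ((nat \<Rightarrow> real) \<Rightarrow> (nat \<Rightarrow> real) \<Rightarrow> real) \<Rightarrow> bool" where
  "location_family p f \<longleftrightarrow>
     (\<forall>\<mu>\<in>Rn p. is_density p (f \<mu>)) \<and>
     (\<forall>\<mu>\<in>Rn p. \<forall>x\<in>Rn p. f \<mu> x = f (vzero p) (vdiff p x \<mu>))"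

text \<open>A sample is a function \<open>x\<close> on the index set \<open>{1..n + n'}\<close>: the observations \<open>x 1, \<dots>, x n\<close>
  are drawn from \<open>f \<mu>\<close> and \<open>x (n + 1), \<dots>, x (n + n')\<close> from \<open>f \<mu>'\<close>, all independently.\<close>

definition sample_law ::
  "nat \<Rightarrow> ((nat \<Rightarrow> real) \<Rightarrow> (nat \<Rightarrow> real) \<Rightarrow> real) \<Rightarrow> nat \<Rightarrow> nat \<Rightarrow>
   (nat \<Rightarrow> real) \<Rightarrow> (nat \<Rightarrow> real) \<Rightarrow> (nat \<Rightarrow> nat \<Rightarrow> real) measure" where
  "sample_law p f n n' \<mu> \<mu>' =
     Pi\<^sub>M {1..n + n'} (\<lambda>i. density (lborel_Rn p) (\<lambda>x. ennreal (f (if i \<le> n then \<mu> else \<mu>') x)))"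

definition first_mean :: "nat \<Rightarrow> nat \<Rightarrow> (nat \<Rightarrow> nat \<Rightarrow> real) \<Rightarrow> nat \<Rightarrow> real" where
  "first_mean p n x = (\<lambda>j\<in>{..<p}. (\<Sum>i\<in>{1..n}. x i j) / real n)"

definition last_mean :: "nat \<Rightarrow> nat \<Rightarrow> nat \<Rightarrow> (nat \<Rightarrow> nat \<Rightarrow> real) \<Rightarrow> nat \<Rightarrow> real" where
  "last_mean p n n' x = (\<lambda>j\<in>{..<p}. (\<Sum>i\<in>{n + 1..n + n'}. x i j) / real n')"

definition mean_diff_stat ::
  "nat \<Rightarrow> ((nat \<Rightarrow> real) \<Rightarrow> real) \<Rightarrow> nat \<Rightarrow> nat \<Rightarrow> (nat \<Rightarrow> nat \<Rightarrow> real) \<Rightarrow> real" where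
  "mean_diff_stat p N n n' x = N (vdiff p (first_mean p n x) (last_mean p n n' x))"

text \<open>The left action of the symmetric group on samples: the observation at position \<open>i\<close> moves
  to position \<open>g i\<close>.\<close>

definition perm_act :: "(nat \<Rightarrow> nat) \<Rightarrow> (nat \<Rightarrow> nat \<Rightarrow> real) \<Rightarrow> nat \<Rightarrow> nat \<Rightarrow> real" where
  "perm_act g x = (\<lambda>i. x (inv g i))"

definition random_perms :: "nat \<Rightarrow> nat \<Rightarrow> (nat \<Rightarrow> nat \<Rightarrow> nat) measure" where
  "random_perms K n = Pi\<^sub>M {1..K} (\<lambda>_. uniform_count_measure {g. g permutes {1..n}})"

text \<open>The \<open>k\<close>-th smallest value counted with multiplicity, for \<open>k \<le> length xs\<close>.\<close>

definition order_stat :: "real list \<Rightarrow> nat \<Rightarrow> ereal" where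
  "order_stat xs k = (if k = 0 then -\<infinity> else ereal (sort xs ! (k - 1)))"

definition randomization_rejects ::
  "real \<Rightarrow> nat \<Rightarrow> ((nat \<Rightarrow> nat \<Rightarrow> real) \<Rightarrow> real) \<Rightarrow>
   (nat \<Rightarrow> nat \<Rightarrow> real) \<Rightarrow> (nat \<Rightarrow> nat \<Rightarrow> nat) \<Rightarrow> bool" where
  "randomization_rejects \<alpha> K T x g \<longleftrightarrow>
     ereal (T x) >
       order_stat (T x # map (\<lambda>j. T (perm_act (g j) x)) [1..<K + 1]) (nat \<lceil>(1 - \<alpha>) * real (K + 1)\<rceil>)"

definition rejection_prob ::
  "real \<Rightarrow> nat \<Rightarrow> nat \<Rightarrow> ((nat \<Rightarrow> real) \<Rightarrow> real) \<Rightarrow>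
   ((nat \<Rightarrow> real) \<Rightarrow> (nat \<Rightarrow> real) \<Rightarrow> real) \<Rightarrow> nat \<Rightarrow> nat \<Rightarrow>
   (nat \<Rightarrow> real) \<Rightarrow> (nat \<Rightarrow> real) \<Rightarrow> real" where
  "rejection_prob \<alpha> K p N f n n' \<mu> \<mu>' =
     \<P>(\<omega> in sample_law p f n n' \<mu> \<mu>' \<Otimes>\<^sub>M random_perms K (n + n').
        randomization_rejects \<alpha> K (mean_diff_stat p N n n') (fst \<omega>) (snd \<omega>))"

text \<open>\<open>\<beta> m \<theta>\<close> is the rejection probability of the \<open>m\<close>-th test at the parameter \<open>\<theta>\<close>. Here and in
  all hypotheses, sequences are indexed by \<open>m \<ge> 1\<close>.\<close>

definition consistent_against :: "(nat \<Rightarrow> 'b \<Rightarrow> real) \<Rightarrow> (nat \<Rightarrow> 'b set) \<Rightarrow> bool" where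
  "consistent_against \<beta> \<Theta> \<longleftrightarrow>
     (\<forall>\<theta>. (\<forall>m\<ge>1. \<theta> m \<in> \<Theta> m) \<longrightarrow> (\<lambda>m. \<beta> m (\<theta> m)) \<longlonglongrightarrow> 1)"

end

theory Submission
  imports Defs
begin

text \<open>Subtracting the means from the observations leaves a sample \<open>\<epsilon>\<close> of the noise, whose law is
  invariant under permutations. After the permutation \<open>g\<close> the difference of means equals that of the
  permuted noise plus \<open>c g * (\<mu> - \<mu>')\<close>, where \<open>c g\<close> is centred with variance
  \<open>1 / (n + n' - 1)\<close> for uniform \<open>g\<close>, whatever the balance of \<open>n\<close> and \<open>n'\<close>, and \<open>c id = 1\<close>. With
  high probability the noise terms of all \<open>K + 1\<close> arrangements are at most \<open>t\<close> and all \<open>\<bar>c g\<bar>\<close>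
  are at most \<open>\<eta> = 1 - 2 / y\<close>; then the observed statistic, at least \<open>\<delta> - t\<close> with \<open>\<delta>\<close> the norm of
  \<open>\<mu>' - \<mu>\<close>, exceeds all the permuted ones, which are at most \<open>\<eta> * \<delta> + t\<close>, because \<open>\<delta> / t\<close> stays
  above \<open>y > 2\<close>. Since \<open>1 / (K + 1) \<le> \<alpha>\<close>, the critical order
  statistic has index at most \<open>K\<close>, so that this suffices for rejection.\<close>

section \<open>Sampling without replacement\<close>

text \<open>Composing with the transposition of \<open>k\<close> and \<open>l\<close> permutes the
  summands, so the sum does not depend on \<open>k\<close>. Summing it over all positions instead,
  each \<open>g\<close> merely rearranges \<open>A\<close>.\<close>

lemma sum_permutes_apply:
  fixes v :: "'a \<Rightarrow> real"
  assumes A: "finite A" and k: "k \<in> A"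
  shows "real (card A) * (\<Sum>g | g permutes A. v (g k)) = fact (card A) * (\<Sum>i\<in>A. v i)"
proof -
  have "(\<Sum>g | g permutes A. v (g k)) = (\<Sum>g | g permutes A. v (g l))" if "l \<in> A" for l
    using sum_permutations_compose_right[OF permutes_swap_id[OF k that], of "\<lambda>g. v (g k)"] by simp
  then have "real (card A) * (\<Sum>g | g permutes A. v (g k)) = (\<Sum>l\<in>A. \<Sum>g | g permutes A. v (g l))"
    by (metis (no_types, lifting) sum.cong sum_constant)
  also have "\<dots> = (\<Sum>g | g permutes A. \<Sum>l\<in>A. v (g l))"
    by (rule sum.swap)
  also have "\<dots> = (\<Sum>g | g permutes A. \<Sum>i\<in>A. v i)"
    by (intro sum.cong refl sum.reindex_bij_betw permutes_imp_bij) simp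
  also have "\<dots> = fact (card A) * (\<Sum>i\<in>A. v i)"
    using card_permutations[OF refl A] by simp
  finally show ?thesis .
qed

text \<open>By symmetry every second position gives the same cross moment. Since \<open>v\<close>
  has total 0, the values of \<open>v\<close> at all positions but \<open>k\<close> add up to
  \<open>- v (g k)\<close>, whatever \<open>g\<close> is, which turns the sum of the cross moments
  into a second moment.\<close>

lemma sum_permutes_apply_pair:
  fixes v :: "'a \<Rightarrow> real"
  assumes A: "finite A" and v: "(\<Sum>i\<in>A. v i) = 0" and k: "k \<in> A" and l: "l \<in> A" "l \<noteq> k"
  shows "(real (card A) - 1) * (\<Sum>g | g permutes A. v (g k) * v (g l)) =
    - (\<Sum>g | g permutes A. (v (g k))\<^sup>2)"
proof -
  \<comment> \<open>The transposition of \<open>l\<close> and \<open>l'\<close> fixes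
    \<open>k\<close>, as both differ from it.\<close>
  have eq: "(\<Sum>g | g permutes A. v (g k) * v (g l)) = (\<Sum>g | g permutes A. v (g k) * v (g l'))"
    if "l' \<in> A - {k}" for l'
    using sum_permutations_compose_right[OF permutes_swap_id[of l A l'], of "\<lambda>g. v (g k) * v (g l)"]
      that l by (auto simp: transpose_def)
  have card: "real (card (A - {k})) = real (card A) - 1"
    using A k by (metis card_Suc_Diff1 add_diff_cancel_left' of_nat_Suc)
  have "(real (card A) - 1) * (\<Sum>g | g permutes A. v (g k) * v (g l)) =
      (\<Sum>l'\<in>A - {k}. \<Sum>g | g permutes A. v (g k) * v (g l))"
    by (simp add: card)
  also have "\<dots> = (\<Sum>l'\<in>A - {k}. \<Sum>g | g permutes A. v (g k) * v (g l'))"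
    by (intro sum.cong refl eq)
  also have "\<dots> = (\<Sum>g | g permutes A. v (g k) * (\<Sum>l'\<in>A - {k}. v (g l')))"
    by (subst sum.swap) (simp add: sum_distrib_left)
  also have "\<dots> = (\<Sum>g | g permutes A. - (v (g k))\<^sup>2)"
  proof (rule sum.cong[OF refl])
    fix g assume "g \<in> {g. g permutes A}"
    then have "(\<Sum>l\<in>A. v (g l)) = 0"
      using v sum.reindex_bij_betw[OF permutes_imp_bij, of g A v] by simp
    then have "(\<Sum>l'\<in>A - {k}. v (g l')) = - v (g k)"
      using A k by (simp add: sum.remove)
    then show "v (g k) * (\<Sum>l'\<in>A - {k}. v (g l')) = - (v (g k))\<^sup>2"
      by (simp add: power2_eq_square)
  qed
  finally show ?thesis by (simp add: sum_negf)
qed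

text \<open>Up to the factor \<open>fact (card A)\<close>, this is the classical finite-population
  variance of the total of \<open>card S\<close> draws. Expanding the square leaves equal diagonal
  terms and equal, negative off-diagonal ones.\<close>

lemma sampling_without_replacement_variance:
  fixes v :: "'a \<Rightarrow> real"
  assumes A: "finite A" "card A \<ge> 2" and v: "(\<Sum>i\<in>A. v i) = 0" and S: "S \<subseteq> A"
  shows "(\<Sum>g | g permutes A. (\<Sum>k\<in>S. v (g k))\<^sup>2) =
    fact (card A) * (real (card S) * real (card A - card S) * (\<Sum>i\<in>A. (v i)\<^sup>2)
      / (real (card A) * (real (card A) - 1)))"
proof -
  define N where "N = real (card A)"
  \<comment> \<open>The common value of the diagonal terms; each off-diagonal term is then
    \<open>- s / (N - 1)\<close>.\<close>
  define s where "s = fact (card A) * (\<Sum>i\<in>A. (v i)\<^sup>2) / N"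
  have N: "N \<ge> 2" using A by (simp add: N_def)
  have fS: "finite S" using S A by (rule_tac finite_subset)
  have cS: "card S \<le> card A" using S A by (simp add: card_mono)
  have diag: "(\<Sum>g | g permutes A. (v (g k))\<^sup>2) = s" if "k \<in> S" for k
    using sum_permutes_apply[OF A(1), of k "\<lambda>i. (v i)\<^sup>2"] that S N
    by (auto simp: s_def N_def field_simps)
  have off: "(\<Sum>g | g permutes A. v (g k) * v (g l)) = - s / (N - 1)"
    if "k \<in> S" "l \<in> S" "l \<noteq> k" for k l
    using sum_permutes_apply_pair[OF A(1) v, of k l] diag[OF that(1)] that S N
    by (auto simp: N_def field_simps)
  have "(\<Sum>g | g permutes A. (\<Sum>k\<in>S. v (g k))\<^sup>2) =
      (\<Sum>g | g permutes A. \<Sum>k\<in>S. \<Sum>l\<in>S. v (g k) * v (g l))"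
    by (simp add: power2_eq_square sum_product)
  also have "\<dots> = (\<Sum>k\<in>S. \<Sum>g | g permutes A. \<Sum>l\<in>S. v (g k) * v (g l))"
    by (rule sum.swap)
  also have "\<dots> = (\<Sum>k\<in>S. \<Sum>l\<in>S. \<Sum>g | g permutes A. v (g k) * v (g l))"
    by (intro sum.cong refl sum.swap)
  also have "\<dots> = (\<Sum>k\<in>S. s + (real (card S) - 1) * (- s / (N - 1)))"
  proof (rule sum.cong[OF refl])
    fix k assume k: "k \<in> S"
    have "(\<Sum>l\<in>S. \<Sum>g | g permutes A. v (g k) * v (g l)) =
        s + (\<Sum>l\<in>S - {k}. \<Sum>g | g permutes A. v (g k) * v (g l))"
      using diag[OF k] by (subst sum.remove[OF fS k]) (simp add: power2_eq_square)
    also have "(\<Sum>l\<in>S - {k}. \<Sum>g | g permutes A. v (g k) * v (g l)) =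
        (\<Sum>l\<in>S - {k}. - s / (N - 1))"
      using off k by (intro sum.cong) auto
    also have "\<dots> = (real (card S) - 1) * (- s / (N - 1))"
      by (simp add: card_Suc_Diff1[OF fS k, symmetric] del: card_Diff_singleton card_Diff_insert)
    finally show "(\<Sum>l\<in>S. \<Sum>g | g permutes A. v (g k) * v (g l)) =
        s + (real (card S) - 1) * (- s / (N - 1))" .
  qed
  also have "\<dots> = real (card S) * (N - real (card S)) * s / (N - 1)"
    using N by (simp add: field_simps)
  also have "\<dots> = fact (card A) * (real (card S) * real (card A - card S) * (\<Sum>i\<in>A. (v i)\<^sup>2)
      / (real (card A) * (real (card A) - 1)))"
    using cS by (simp add: s_def N_def of_nat_diff field_simps)
  finally show ?thesis .
qed

section \<open>The difference of means as a weighted sum\<close>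

text \<open>Writes the difference of means as a single linear statistic, so that permuting the
  observations becomes permuting the weights.\<close>

definition two_sample_weight :: "nat \<Rightarrow> nat \<Rightarrow> nat \<Rightarrow> real" where
  "two_sample_weight n n' i = (if i \<le> n then 1 / real n else - 1 / real n')"

lemma sum_two_blocks:
  fixes n n' :: nat
  shows "(\<Sum>i\<in>{1..n + n'}. h i) = (\<Sum>i\<in>{1..n}. h i) + (\<Sum>i\<in>{n + 1..n + n'}. h i :: real)"
  by (rule sum.ub_add_nat) simp

lemma sum_two_sample_weight:
  assumes "n \<ge> 1" "n' \<ge> 1"
  shows "(\<Sum>i\<in>{1..n + n'}. two_sample_weight n n' i) = 0"
    and "(\<Sum>i\<in>{1..n + n'}. (two_sample_weight n n' i)\<^sup>2) = 1 / real n + 1 / real n'"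
    and "(\<Sum>i\<in>{1..n}. two_sample_weight n n' i) = 1"
  using assms unfolding sum_two_blocks
  by (simp_all add: two_sample_weight_def power2_eq_square)

lemma mean_diff_stat_eq:
  "mean_diff_stat p N n n' x =
    N (\<lambda>j\<in>{..<p}. \<Sum>i\<in>{1..n + n'}. two_sample_weight n n' i * x i j)"
proof -
  have "vdiff p (first_mean p n x) (last_mean p n n' x) =
      (\<lambda>j\<in>{..<p}. \<Sum>i\<in>{1..n + n'}. two_sample_weight n n' i * x i j)"
    unfolding sum_two_blocks
    by (auto simp: vdiff_def first_mean_def last_mean_def two_sample_weight_def sum_divide_distrib
        fun_eq_iff simp flip: sum_negf)
  then show ?thesis by (simp add: mean_diff_stat_def)
qed

text \<open>The coefficient of \<open>\<mu> - \<mu>'\<close> in the difference of means after the permutation \<open>g\<close>.\<close>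

definition contrast :: "nat \<Rightarrow> nat \<Rightarrow> (nat \<Rightarrow> nat) \<Rightarrow> real" where
  "contrast n n' g = (\<Sum>k\<in>{1..n}. two_sample_weight n n' (g k))"

text \<open>The squared weights add up to \<open>(n + n') / (n * n')\<close>, and the product
  \<open>n * n'\<close> cancels against the variance formula. Hence divergence of the total size
  alone makes the contrast of a random permutation small.\<close>

lemma contrast_second_moment:
  assumes "n \<ge> 1" "n' \<ge> 1"
  shows "(\<Sum>g | g permutes {1..n + n'}. (contrast n n' g)\<^sup>2) =
    fact (n + n') / (real (n + n') - 1)"
proof -
  have "(\<Sum>g | g permutes {1..n + n'}. (contrast n n' g)\<^sup>2) =
      fact (n + n') * (real n * real n' * (1 / real n + 1 / real n')
        / (real (n + n') * (real (n + n') - 1)))"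
    unfolding contrast_def sum_two_sample_weight(2)[OF assms, symmetric]
    using assms sum_two_sample_weight(1)[OF assms]
    by (subst sampling_without_replacement_variance) auto
  also have "real n * real n' * (1 / real n + 1 / real n') = real (n + n')"
    using assms by (simp add: field_simps)
  finally show ?thesis using assms by simp
qed

section \<open>Norms\<close>

lemma Rn_simps [simp]:
  "vzero p \<in> Rn p" "vadd p x y \<in> Rn p" "vdiff p x y \<in> Rn p" "vscale p c x \<in> Rn p"
  "restrict h {..<p} \<in> Rn p"
  by (auto simp: Rn_def vzero_def vadd_def vdiff_def vscale_def)

lemma Rn_outside: "x \<in> Rn p \<Longrightarrow> \<not> j < p \<Longrightarrow> x j = undefined"
  by (auto simp: Rn_def PiE_def extensional_def)

lemma Rn_eqI: "x \<in> Rn p \<Longrightarrow> y \<in> Rn p \<Longrightarrow> (\<And>j. j < p \<Longrightarrow> x j = y j) \<Longrightarrow> x = y"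
  by (rule ext) (metis Rn_outside)

context
  fixes p N assumes N: "is_norm p N"
begin

lemma norm_nonneg: "x \<in> Rn p \<Longrightarrow> 0 \<le> N x"
  using N by (simp add: is_norm_def)

lemma norm_scale: "x \<in> Rn p \<Longrightarrow> N (vscale p c x) = \<bar>c\<bar> * N x"
  using N by (simp add: is_norm_def)

lemma norm_triangle: "x \<in> Rn p \<Longrightarrow> y \<in> Rn p \<Longrightarrow> N (vadd p x y) \<le> N x + N y"
  using N by (simp add: is_norm_def)

lemma norm_vdiff_commute: "N (vdiff p x y) = N (vdiff p y x)"
proof -
  have "vdiff p x y = vscale p (- 1) (vdiff p y x)"
    by (auto simp: vdiff_def vscale_def fun_eq_iff)
  then show ?thesis by (simp add: norm_scale)
qed

lemma norm_restrict_sum_le: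
  assumes "finite A"
  shows "N (\<lambda>j\<in>{..<p}. \<Sum>i\<in>A. h i j) \<le> (\<Sum>i\<in>A. N (\<lambda>j\<in>{..<p}. h i j))"
  using assms
proof (induction A)
  case empty
  have "(\<lambda>j\<in>{..<p}. 0) = vzero p" by (simp add: vzero_def)
  moreover have "N (vzero p) = 0" using N by (simp add: is_norm_def)
  ultimately show ?case by simp
next
  case (insert a A)
  have eq: "(\<lambda>j\<in>{..<p}. \<Sum>i\<in>insert a A. h i j) =
      vadd p (\<lambda>j\<in>{..<p}. h a j) (\<lambda>j\<in>{..<p}. \<Sum>i\<in>A. h i j)"
    using insert by (auto simp: vadd_def fun_eq_iff)
  have "N (\<lambda>j\<in>{..<p}. \<Sum>i\<in>insert a A. h i j) \<le>
      N (\<lambda>j\<in>{..<p}. h a j) + N (\<lambda>j\<in>{..<p}. \<Sum>i\<in>A. h i j)"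
    unfolding eq by (intro norm_triangle Rn_simps)
  also have "\<dots> \<le> N (\<lambda>j\<in>{..<p}. h a j) + (\<Sum>i\<in>A. N (\<lambda>j\<in>{..<p}. h i j))"
    using insert.IH by (rule add_left_mono)
  also have "\<dots> = (\<Sum>i\<in>insert a A. N (\<lambda>j\<in>{..<p}. h i j))"
    by (rule sum.insert[OF insert.hyps, symmetric])
  finally show ?case .
qed

lemma norm_diff_le:
  assumes "x \<in> Rn p" "y \<in> Rn p"
  shows "N x - N y \<le> N (vdiff p x y)"
proof -
  have "x = vadd p (vdiff p x y) y"
    by (rule Rn_eqI[OF assms(1)]) (auto simp: vadd_def vdiff_def)
  then show ?thesis using norm_triangle[of "vdiff p x y" y] assms by simp
qed

text \<open>Expand the difference in the standard basis: the Lipschitz constant of coordinate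
  \<open>i\<close> is the norm of the \<open>i\<close>-th unit vector.\<close>

lemma norm_lipschitz:
  fixes x y :: "nat \<Rightarrow> real"
  shows "\<bar>N (restrict x {..<p}) - N (restrict y {..<p})\<bar>
    \<le> (\<Sum>i<p. \<bar>x i - y i\<bar> * N (\<lambda>j\<in>{..<p}. of_bool (j = i)))"
proof -
  have "vdiff p (restrict x {..<p}) (restrict y {..<p}) =
      (\<lambda>j\<in>{..<p}. \<Sum>i<p. (x i - y i) * of_bool (j = i))"
    by (auto simp: vdiff_def fun_eq_iff of_bool_def mult_delta_right)
  then have "N (vdiff p (restrict x {..<p}) (restrict y {..<p})) \<le>
      (\<Sum>i<p. N (\<lambda>j\<in>{..<p}. (x i - y i) * of_bool (j = i)))"
    using norm_restrict_sum_le[of "{..<p}" "\<lambda>i j. (x i - y i) * of_bool (j = i)"] by simp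
  also have "\<dots> = (\<Sum>i<p. \<bar>x i - y i\<bar> * N (\<lambda>j\<in>{..<p}. of_bool (j = i)))"
  proof (rule sum.cong[OF refl])
    fix i
    have "(\<lambda>j\<in>{..<p}. (x i - y i) * of_bool (j = i)) =
        vscale p (x i - y i) (\<lambda>j\<in>{..<p}. of_bool (j = i))"
      by (auto simp: vscale_def fun_eq_iff)
    then show "N (\<lambda>j\<in>{..<p}. (x i - y i) * of_bool (j = i)) =
        \<bar>x i - y i\<bar> * N (\<lambda>j\<in>{..<p}. of_bool (j = i))"
      by (simp add: norm_scale)
  qed
  finally show ?thesis
    using norm_diff_le[of "restrict x {..<p}" "restrict y {..<p}"]
      norm_diff_le[of "restrict y {..<p}" "restrict x {..<p}"]
      norm_vdiff_commute[of "restrict x {..<p}" "restrict y {..<p}"]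
    by simp
qed

text \<open>The norm is an arbitrary function, so its measurability has to come from continuity.
  Precomposing with the restriction puts the statement on all of
  \<open>nat \<Rightarrow> real\<close>, where the product topology is available.\<close>

lemma continuous_on_norm_restrict: "continuous_on UNIV (\<lambda>x. N (restrict x {..<p}))"
  unfolding continuous_on_def
proof (intro ballI)
  fix x :: "nat \<Rightarrow> real"
  have "((\<lambda>y. \<Sum>i<p. \<bar>y i - x i\<bar> * N (\<lambda>j\<in>{..<p}. of_bool (j = i)))
      \<longlongrightarrow> (\<Sum>i<p. \<bar>x i - x i\<bar> * N (\<lambda>j\<in>{..<p}. of_bool (j = i)))) (at x)"
    by (intro tendsto_intros continuous_on_product_coordinates[unfolded continuous_on_def, rule_format])
       simp
  then have "((\<lambda>y. \<Sum>i<p. \<bar>y i - x i\<bar> * N (\<lambda>j\<in>{..<p}. of_bool (j = i))) \<longlongrightarrow> 0) (at x)"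
    by simp
  then have "((\<lambda>y. N (restrict y {..<p}) - N (restrict x {..<p})) \<longlongrightarrow> 0) (at x)"
    by (rule Lim_null_comparison[rotated]) (simp add: norm_lipschitz)
  then show "((\<lambda>y. N (restrict y {..<p})) \<longlongrightarrow> N (restrict x {..<p})) (at x)"
    by (simp add: LIM_zero_iff)
qed

text \<open>Over a countable index set the product sigma-algebra of Borel lines is the Borel
  sigma-algebra of the product topology, so continuity suffices.\<close>

lemma borel_measurable_norm_restrict:
  assumes "\<And>j. j < p \<Longrightarrow> (\<lambda>\<omega>. h \<omega> j) \<in> borel_measurable M"
  shows "(\<lambda>\<omega>. N (\<lambda>j\<in>{..<p}. h \<omega> j)) \<in> borel_measurable M"
proof -
  have "(\<lambda>x. N (restrict x {..<p})) \<in> borel_measurable (Pi\<^sub>M UNIV (\<lambda>_. borel))"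
    using borel_measurable_continuous_onI[OF continuous_on_norm_restrict]
    by (simp cong: measurable_cong_sets add: measurable_cong_sets[OF sets_PiM_equal_borel refl])
  \<comment> \<open>The hypothesis covers only coordinates below \<open>p\<close>. The others are
    filled with 0, which the restriction then discards.\<close>
  moreover have "(\<lambda>\<omega> j. if j < p then h \<omega> j else 0) \<in> M \<rightarrow>\<^sub>M Pi\<^sub>M UNIV (\<lambda>_. borel)"
    proof (rule measurable_PiM_single')
    show "(\<lambda>\<omega>. if j < p then h \<omega> j else 0) \<in> borel_measurable M" for j
      using assms by (cases "j < p") auto
  qed simp
  ultimately have "(\<lambda>\<omega>. N (restrict (\<lambda>j. if j < p then h \<omega> j else 0) {..<p})) \<in> borel_measurable M"
    by (rule measurable_compose[rotated])
  moreover have "restrict (\<lambda>j. if j < p then h \<omega> j else 0) {..<p} = restrict (h \<omega>) {..<p}" for \<omega>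
    by auto
  ultimately show ?thesis by simp
qed

end

section \<open>Translations of product measures\<close>

text \<open>The preimage of a box under a coordinatewise map is a box, and a product measure is
  determined by its values on boxes.\<close>

lemma distr_PiM_componentwise:
  assumes I: "finite I"
    and M: "\<And>i. sigma_finite_measure (M i)"
    and F: "\<And>i. i \<in> I \<Longrightarrow> F i \<in> M i \<rightarrow>\<^sub>M L i"
    and D: "\<And>i. sigma_finite_measure (distr (M i) (L i) (F i))"
  shows "distr (Pi\<^sub>M I M) (Pi\<^sub>M I L) (\<lambda>x. \<lambda>i\<in>I. F i (x i)) = Pi\<^sub>M I (\<lambda>i. distr (M i) (L i) (F i))"
proof -
  interpret M: product_sigma_finite M by (rule product_sigma_finite.intro) (rule M)
  interpret D: product_sigma_finite "\<lambda>i. distr (M i) (L i) (F i)" by (rule product_sigma_finite.intro) (rule D)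
  have meas: "(\<lambda>x. \<lambda>i\<in>I. F i (x i)) \<in> Pi\<^sub>M I M \<rightarrow>\<^sub>M Pi\<^sub>M I L"
    using F by (intro measurable_restrict measurable_compose[OF measurable_component_singleton]) auto
  show ?thesis
  proof (rule D.PiM_eqI[OF I])
    show "sets (distr (Pi\<^sub>M I M) (Pi\<^sub>M I L) (\<lambda>x. \<lambda>i\<in>I. F i (x i))) =
        sets (Pi\<^sub>M I (\<lambda>i. distr (M i) (L i) (F i)))"
      by (simp cong: sets_PiM_cong)
    fix A assume "\<And>i. i \<in> I \<Longrightarrow> A i \<in> sets (distr (M i) (L i) (F i))"
    then have A: "\<And>i. i \<in> I \<Longrightarrow> A i \<in> sets (L i)" by simp
    have "(\<lambda>x. \<lambda>i\<in>I. F i (x i)) -` Pi\<^sub>E I A \<inter> space (Pi\<^sub>M I M) = Pi\<^sub>E I (\<lambda>i. F i -` A i \<inter> space (M i))"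
      by (auto simp: space_PiM PiE_iff)
    then have "emeasure (distr (Pi\<^sub>M I M) (Pi\<^sub>M I L) (\<lambda>x. \<lambda>i\<in>I. F i (x i))) (Pi\<^sub>E I A) =
        emeasure (Pi\<^sub>M I M) (Pi\<^sub>E I (\<lambda>i. F i -` A i \<inter> space (M i)))"
      using A I by (subst emeasure_distr[OF meas]) (auto intro: sets_PiM_I_finite)
    also have "\<dots> = (\<Prod>i\<in>I. emeasure (M i) (F i -` A i \<inter> space (M i)))"
      using A F I by (intro M.emeasure_PiM) auto
    also have "\<dots> = (\<Prod>i\<in>I. emeasure (distr (M i) (L i) (F i)) (A i))"
      using A F by (intro prod.cong refl) (simp add: emeasure_distr)
    finally show "emeasure (distr (Pi\<^sub>M I M) (Pi\<^sub>M I L) (\<lambda>x. \<lambda>i\<in>I. F i (x i))) (Pi\<^sub>E I A) =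
        (\<Prod>i\<in>I. emeasure (distr (M i) (L i) (F i)) (A i))" .
  qed
qed

section \<open>Translation of Lebesgue measure and of the sample law\<close>

lemma space_lborel_Rn [simp]: "space (lborel_Rn p) = Rn p"
  by (simp add: lborel_Rn_def Rn_def space_PiM)

lemma measurable_lborel_Rn_component [measurable]:
  "j < p \<Longrightarrow> (\<lambda>x. x j) \<in> borel_measurable (lborel_Rn p)"
  unfolding lborel_Rn_def by measurable

lemma measurable_vadd [measurable]: "vadd p \<mu> \<in> lborel_Rn p \<rightarrow>\<^sub>M lborel_Rn p"
  unfolding lborel_Rn_def vadd_def by measurable

lemma distr_vadd_lborel_Rn: "distr (lborel_Rn p) (lborel_Rn p) (vadd p \<mu>) = lborel_Rn p"
proof -
  have "distr lborel lborel ((+) (\<mu> j)) = (lborel :: real measure)" for j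
    using lborel_distr_plus[of "\<mu> j"] by (simp cong: distr_cong)
  then show ?thesis
    using distr_PiM_componentwise[of "{..<p}" "\<lambda>_. lborel" "\<lambda>j. (+) (\<mu> j)" "\<lambda>_. lborel"]
    by (simp add: lborel_Rn_def vadd_def[abs_def] sigma_finite_lborel)
qed

context
  fixes p f assumes family: "location_family p f"
begin

lemma location_familyD:
  assumes "\<mu> \<in> Rn p"
  shows "is_density p (f \<mu>)" "x \<in> Rn p \<Longrightarrow> f \<mu> x = f (vzero p) (vdiff p x \<mu>)"
  using family assms unfolding location_family_def by blast+

lemma location_family_measurable:
  "\<mu> \<in> Rn p \<Longrightarrow> (\<lambda>x. ennreal (f \<mu> x)) \<in> borel_measurable (lborel_Rn p)"
  by (intro measurable_compose[OF _ measurable_ennreal])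
     (simp add: location_familyD(1)[unfolded is_density_def])

lemma location_family_prob_space:
  assumes "\<mu> \<in> Rn p"
  shows "prob_space (density (lborel_Rn p) (\<lambda>x. ennreal (f \<mu> x)))"
proof (rule prob_spaceI)
  have "emeasure (density (lborel_Rn p) (\<lambda>x. ennreal (f \<mu> x))) (space (lborel_Rn p)) =
      (\<integral>\<^sup>+x. ennreal (f \<mu> x) * indicator (space (lborel_Rn p)) x \<partial>lborel_Rn p)"
    by (rule emeasure_density[OF location_family_measurable[OF assms] sets.top])
  also have "\<dots> = (\<integral>\<^sup>+x. ennreal (f \<mu> x) \<partial>lborel_Rn p)"
    by (intro nn_integral_cong) (simp only: indicator_simps mult_1_right)
  also have "\<dots> = 1"
    using location_familyD(1)[OF assms] by (simp add: is_density_def)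
  finally show "emeasure (density (lborel_Rn p) (\<lambda>x. ennreal (f \<mu> x)))
      (space (density (lborel_Rn p) (\<lambda>x. ennreal (f \<mu> x)))) = 1"
    by (simp only: space_density)
qed

text \<open>Change of variables: Lebesgue measure is its own translate, so the shift can be moved
  from the density to the map.\<close>

lemma location_family_shift:
  assumes \<mu>: "\<mu> \<in> Rn p"
  shows "density (lborel_Rn p) (\<lambda>x. ennreal (f \<mu> x)) =
    distr (density (lborel_Rn p) (\<lambda>x. ennreal (f (vzero p) x))) (lborel_Rn p) (vadd p \<mu>)"
proof -
  have shift: "f \<mu> (vadd p \<mu> x) = f (vzero p) x" if "x \<in> Rn p" for x
  proof -
    have "vdiff p (vadd p \<mu> x) \<mu> = x"
      by (rule Rn_eqI[OF _ that]) (auto simp: vdiff_def vadd_def)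
    then show ?thesis
      using location_familyD(2)[OF \<mu>, of "vadd p \<mu> x"] by simp
  qed
  have "density (lborel_Rn p) (\<lambda>x. ennreal (f \<mu> x)) =
      density (distr (lborel_Rn p) (lborel_Rn p) (vadd p \<mu>)) (\<lambda>x. ennreal (f \<mu> x))"
    by (simp add: distr_vadd_lborel_Rn)
  also have "\<dots> = distr (density (lborel_Rn p) (\<lambda>x. ennreal (f \<mu> (vadd p \<mu> x)))) (lborel_Rn p) (vadd p \<mu>)"
    using location_family_measurable[OF \<mu>] by (intro density_distr) auto
  also have "density (lborel_Rn p) (\<lambda>x. ennreal (f \<mu> (vadd p \<mu> x))) =
      density (lborel_Rn p) (\<lambda>x. ennreal (f (vzero p) x))"
    using location_family_measurable[OF \<mu>] location_family_measurable[of "vzero p"]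
    by (intro density_cong) (auto simp: shift)
  finally show ?thesis .
qed

text \<open>Realises every sample as means plus noise from one fixed law, so that events under the
  alternative can be bounded by noise events.\<close>

lemma sample_law_shift:
  assumes "\<mu> \<in> Rn p" "\<mu>' \<in> Rn p"
  shows "sample_law p f n n' \<mu> \<mu>' =
    distr (sample_law p f n n' (vzero p) (vzero p)) (Pi\<^sub>M {1..n + n'} (\<lambda>_. lborel_Rn p))
      (\<lambda>x. \<lambda>i\<in>{1..n + n'}. vadd p (if i \<le> n then \<mu> else \<mu>') (x i))"
proof -
  let ?M = "density (lborel_Rn p) (\<lambda>x. ennreal (f (vzero p) x))"
  let ?s = "\<lambda>i. if i \<le> n then \<mu> else \<mu>'"
  have s: "?s i \<in> Rn p" for i using assms by simp
  have "sample_law p f n n' \<mu> \<mu>' =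
      Pi\<^sub>M {1..n + n'} (\<lambda>i. distr ?M (lborel_Rn p) (vadd p (?s i)))"
    unfolding sample_law_def by (simp only: location_family_shift[OF s])
  also have "\<dots> = distr (Pi\<^sub>M {1..n + n'} (\<lambda>_. ?M)) (Pi\<^sub>M {1..n + n'} (\<lambda>_. lborel_Rn p))
      (\<lambda>x. \<lambda>i\<in>{1..n + n'}. vadd p (?s i) (x i))"
  proof (rule distr_PiM_componentwise[symmetric])
    show "sigma_finite_measure ?M"
      by (intro prob_space_imp_sigma_finite location_family_prob_space Rn_simps)
    show "sigma_finite_measure (distr ?M (lborel_Rn p) (vadd p (?s i)))" for i
      unfolding location_family_shift[OF s, symmetric]
      by (intro prob_space_imp_sigma_finite location_family_prob_space s)
  qed simp_all
  also have "Pi\<^sub>M {1..n + n'} (\<lambda>_. ?M) = sample_law p f n n' (vzero p) (vzero p)"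
    by (simp add: sample_law_def)
  finally show ?thesis .
qed

end

lemma sets_sample_law [measurable_cong]:
  "sets (sample_law p f n n' \<mu> \<mu>') = sets (Pi\<^sub>M {1..n + n'} (\<lambda>_. lborel_Rn p))"
  unfolding sample_law_def by (intro sets_PiM_cong) auto

lemma space_sample_law [simp]: "space (sample_law p f n n' \<mu> \<mu>') = {1..n + n'} \<rightarrow>\<^sub>E Rn p"
  by (simp add: sample_law_def space_PiM)

lemma prob_space_sample_law:
  assumes "location_family p f" "\<mu> \<in> Rn p" "\<mu>' \<in> Rn p"
  shows "prob_space (sample_law p f n n' \<mu> \<mu>')"
  unfolding sample_law_def using assms
  by (intro prob_space_PiM location_family_prob_space) auto

section \<open>The statistic under permutations and shifts\<close>

text \<open>Reindexing the sum by \<open>g\<close> cancels the inverse in the action: the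
  observations stay in place and the weights move.\<close>

lemma mean_diff_stat_perm:
  assumes "g permutes {1..n + n'}"
  shows "mean_diff_stat p N n n' (perm_act g x) =
    N (\<lambda>j\<in>{..<p}. \<Sum>k\<in>{1..n + n'}. two_sample_weight n n' (g k) * x k j)"
proof -
  have "(\<Sum>i\<in>{1..n + n'}. two_sample_weight n n' i * perm_act g x i j) =
      (\<Sum>k\<in>{1..n + n'}. two_sample_weight n n' (g k) * x k j)" for j
    using permutes_imp_bij[OF assms] permutes_inverses(2)[OF assms]
    by (subst sum.reindex_bij_betw[symmetric, of g "{1..n + n'}"]) (auto simp: perm_act_def)
  then show ?thesis unfolding mean_diff_stat_eq by simp
qed

lemma measurable_mean_diff_stat_perm:
  assumes "is_norm p N" "g permutes {1..n + n'}"
  shows "(\<lambda>x. mean_diff_stat p N n n' (perm_act g x)) \<in> borel_measurable (Pi\<^sub>M {1..n + n'} (\<lambda>_. lborel_Rn p))"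
proof -
  have "(\<lambda>x. x k j) \<in> borel_measurable (Pi\<^sub>M {1..n + n'} (\<lambda>_. lborel_Rn p))"
    if "k \<in> {1..n + n'}" "j < p" for k j
    using measurable_compose[OF measurable_component_singleton[OF that(1)]
        measurable_lborel_Rn_component[OF that(2)]] .
  then show ?thesis
    unfolding mean_diff_stat_perm[OF assms(2)]
    by (intro borel_measurable_norm_restrict[OF assms(1)] borel_measurable_sum borel_measurable_times) auto
qed

lemma perm_act_id [simp]: "perm_act id x = x"
  by (simp add: perm_act_def)

lemma contrast_id: "n \<ge> 1 \<Longrightarrow> contrast n n' id = 1"
  by (simp add: contrast_def two_sample_weight_def)

text \<open>By linearity the permuted difference of means of \<open>x\<close> is that of the noise
  plus \<open>contrast n n' g\<close> times \<open>\<mu> - \<mu>'\<close>; the reverse triangle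
  inequality does the rest.\<close>

lemma mean_diff_stat_shift:
  assumes N: "is_norm p N" and n: "n \<ge> 1" "n' \<ge> 1" and g: "g permutes {1..n + n'}"
    and x: "x = (\<lambda>i\<in>{1..n + n'}. vadd p (if i \<le> n then \<mu> else \<mu>') (\<epsilon> i))"
  shows "\<bar>mean_diff_stat p N n n' (perm_act g x) - \<bar>contrast n n' g\<bar> * N (vdiff p \<mu>' \<mu>)\<bar>
    \<le> mean_diff_stat p N n n' (perm_act g \<epsilon>)"
proof -
  define w where "w = two_sample_weight n n'"
  let ?I = "{1..n + n'}"
  define a where "a = (\<lambda>j\<in>{..<p}. \<Sum>k\<in>?I. w (g k) * x k j)"
  define e where "e = (\<lambda>j\<in>{..<p}. \<Sum>k\<in>?I. w (g k) * \<epsilon> k j)"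
  define d where "d = vscale p (contrast n n' g) (vdiff p \<mu> \<mu>')"
  have w0: "(\<Sum>k\<in>?I. w (g k)) = 0"
    using sum_two_sample_weight(1)[OF n] sum.reindex_bij_betw[OF permutes_imp_bij[OF g], of w]
    by (simp add: w_def)
  have "(\<Sum>k\<in>?I. w (g k) * x k j) = (\<Sum>k\<in>?I. w (g k) * \<epsilon> k j) + contrast n n' g * (\<mu> j - \<mu>' j)"
    if "j < p" for j
  proof -
    \<comment> \<open>Each mean is split as \<open>\<mu>'\<close> plus, on the first
      \<open>n\<close> positions, \<open>\<mu> - \<mu>'\<close>. The common part vanishes because
      the permuted weights still have total 0.\<close>
    have "(\<Sum>k\<in>?I. w (g k) * x k j) =
        (\<Sum>k\<in>?I. w (g k) * \<epsilon> k j + \<mu>' j * w (g k) + (\<mu> j - \<mu>' j) * (if k \<le> n then w (g k) else 0))"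
      using that by (intro sum.cong) (auto simp: x vadd_def algebra_simps)
    also have "\<dots> = (\<Sum>k\<in>?I. w (g k) * \<epsilon> k j) + (\<mu> j - \<mu>' j) * (\<Sum>k\<in>?I. if k \<le> n then w (g k) else 0)"
      using w0 by (simp add: sum.distrib flip: sum_distrib_left)
    also have "(\<Sum>k\<in>?I. if k \<le> n then w (g k) else 0) = contrast n n' g"
      unfolding sum_two_blocks by (simp add: contrast_def w_def)
    finally show ?thesis by simp
  qed
  then have ed: "vdiff p a d = e" "vdiff p d a = vscale p (-1) e"
    by (auto simp: a_def e_def d_def vdiff_def vscale_def fun_eq_iff)
  have Rn: "a \<in> Rn p" "e \<in> Rn p" "d \<in> Rn p" by (simp_all add: a_def e_def d_def)
  have "\<bar>N a - N d\<bar> \<le> N e"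
    using norm_diff_le[OF N Rn(1,3)] norm_diff_le[OF N Rn(3,1)] norm_scale[OF N Rn(2), of "-1"]
    by (simp add: ed)
  moreover have "N d = \<bar>contrast n n' g\<bar> * N (vdiff p \<mu>' \<mu>)"
    by (simp add: d_def norm_scale[OF N] norm_vdiff_commute[OF N, of \<mu> \<mu>'])
  ultimately show ?thesis
    by (simp add: mean_diff_stat_perm[OF g] a_def e_def w_def)
qed

text \<open>At equal parameters all factors of the product coincide, so relabelling the coordinates
  preserves the law.\<close>

lemma sample_law_exchangeable:
  assumes f: "location_family p f" and N: "is_norm p N" and g: "g permutes {1..n + n'}"
  shows "\<P>(\<epsilon> in sample_law p f n n' (vzero p) (vzero p). mean_diff_stat p N n n' (perm_act g \<epsilon>) \<le> t) =
    \<P>(\<epsilon> in sample_law p f n n' (vzero p) (vzero p). mean_diff_stat p N n n' \<epsilon> \<le> t)"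
proof -
  let ?I = "{1..n + n'}" and ?T = "mean_diff_stat p N n n'"
  let ?P = "sample_law p f n n' (vzero p) (vzero p)"
  \<comment> \<open>The action cut down to the index set, which makes it a map between product
    spaces; the statistic reads only these coordinates.\<close>
  let ?\<phi> = "\<lambda>\<epsilon>. \<lambda>i\<in>?I. \<epsilon> (inv g i)"
  have g': "inv g permutes ?I" by (rule permutes_inv[OF g])
  have distr: "distr ?P ?P ?\<phi> = ?P"
    using distr_PiM_reindex[of ?I "\<lambda>_. density (lborel_Rn p) (\<lambda>x. ennreal (f (vzero p) x))" "inv g" ?I]
      location_family_prob_space[OF f, of "vzero p"] permutes_inj_on[OF g'] permutes_in_image[OF g']
    by (auto simp: sample_law_def)
  have meas: "?\<phi> \<in> ?P \<rightarrow>\<^sub>M ?P"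
    unfolding sample_law_def using permutes_in_image[OF g']
    by (intro measurable_restrict) (auto intro!: measurable_component_singleton)
  have T: "?T (?\<phi> \<epsilon>) = ?T (perm_act g \<epsilon>)" for \<epsilon>
    unfolding mean_diff_stat_eq by (auto intro!: arg_cong[of _ _ N] sum.cong simp: fun_eq_iff perm_act_def)
  have sets: "{\<epsilon> \<in> space ?P. ?T \<epsilon> \<le> t} \<in> sets ?P"
  proof (rule borel_measurable_le)
    show "?T \<in> borel_measurable ?P"
      using measurable_mean_diff_stat_perm[OF N permutes_id, of n n']
      by (simp cong: measurable_cong_sets add: measurable_cong_sets[OF sets_sample_law refl])
  qed simp
  have "measure ?P {\<epsilon> \<in> space ?P. ?T \<epsilon> \<le> t} = measure (distr ?P ?P ?\<phi>) {\<epsilon> \<in> space ?P. ?T \<epsilon> \<le> t}"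
    by (simp only: distr)
  also have "\<dots> = measure ?P (?\<phi> -` {\<epsilon> \<in> space ?P. ?T \<epsilon> \<le> t} \<inter> space ?P)"
    by (rule measure_distr[OF meas sets])
  also have "?\<phi> -` {\<epsilon> \<in> space ?P. ?T \<epsilon> \<le> t} \<inter> space ?P = {\<epsilon> \<in> space ?P. ?T (perm_act g \<epsilon>) \<le> t}"
    using measurable_space[OF meas] by (auto simp: T simp del: space_sample_law One_nat_def)
  finally show ?thesis by simp
qed

section \<open>The rejection event\<close>

text \<open>In the sorted list the entries below \<open>c\<close> form an initial segment. For
  \<open>k = 0\<close> both sides are true, the order statistic being minus infinity.\<close>

lemma order_stat_less_iff:
  assumes "k \<le> length xs"
  shows "order_stat xs k < ereal c \<longleftrightarrow> k \<le> length (filter (\<lambda>y. y < c) xs)"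
proof (cases "k = 0")
  case False
  define ys where "ys = sort xs"
  have ys: "sorted ys" "k - 1 < length ys" using assms False by (auto simp: ys_def)
  have len: "length (filter (\<lambda>y. y < c) xs) = length (filter (\<lambda>y. y < c) ys)"
    by (metis ys_def mset_filter mset_sort size_mset)
  have "ys ! (k - 1) < c \<longleftrightarrow> k \<le> length (filter (\<lambda>y. y < c) ys)"
  proof
    assume less: "ys ! (k - 1) < c"
    have "y < c" if "y \<in> set (take k ys)" for y
    proof -
      obtain i where "i < k" "i < length ys" "y = ys ! i"
        using \<open>y \<in> set (take k ys)\<close> by (auto simp: in_set_conv_nth)
      then have "y \<le> ys ! (k - 1)" using ys by (auto intro!: sorted_nth_mono)
      then show ?thesis using less by simp
    qed
    then have "filter (\<lambda>y. y < c) (take k ys) = take k ys" by simp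
    then have "k \<le> length (filter (\<lambda>y. y < c) (take k ys @ drop k ys))"
      using ys(2) False by (simp only: filter_append length_append) simp
    then show "k \<le> length (filter (\<lambda>y. y < c) ys)" by simp
  next
    \<comment> \<open>Otherwise no entry from position \<open>k - 1\<close> onwards is below
      \<open>c\<close>, leaving at most \<open>k - 1\<close> such entries.\<close>
    assume le: "k \<le> length (filter (\<lambda>y. y < c) ys)"
    show "ys ! (k - 1) < c"
    proof (rule ccontr)
      assume ge: "\<not> ys ! (k - 1) < c"
      have "\<not> y < c" if "y \<in> set (drop (k - 1) ys)" for y
      proof -
        obtain i where "k - 1 + i < length ys" "y = ys ! (k - 1 + i)"
          using \<open>y \<in> set (drop (k - 1) ys)\<close> by (auto simp: in_set_conv_nth add.commute less_diff_conv)
        then have "ys ! (k - 1) \<le> y" using ys by (auto intro!: sorted_nth_mono)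
        then show ?thesis using ge by simp
      qed
      then have drop: "filter (\<lambda>y. y < c) (drop (k - 1) ys) = []" by (auto simp: filter_empty_conv)
      have "length (filter (\<lambda>y. y < c) (take (k - 1) ys @ drop (k - 1) ys)) \<le> k - 1"
        unfolding filter_append drop
        by (metis append_Nil2 length_filter_le length_take min.boundedE order_trans order_refl)
      then show False using le False by simp
    qed
  qed
  then show ?thesis using False by (simp add: order_stat_def len flip: ys_def)
qed (simp add: order_stat_def)

lemma critical_index_le:
  assumes "1 / real (K + 1) \<le> \<alpha>"
  shows "nat \<lceil>(1 - \<alpha>) * real (K + 1)\<rceil> \<le> K"
proof -
  have "1 \<le> \<alpha> * real (K + 1)" using assms by (simp add: field_simps)
  then have "(1 - \<alpha>) * real (K + 1) \<le> real_of_int (int K)" by (simp add: algebra_simps)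
  then show ?thesis by (simp only: ceiling_le_iff nat_le_iff)
qed

text \<open>The observed value is in the ordered list but not strictly below itself, so only the
  \<open>K\<close> permuted values count. In this form rejection is a condition on a count of
  finitely many comparisons.\<close>

lemma randomization_rejects_iff:
  assumes "1 / real (K + 1) \<le> \<alpha>"
  shows "randomization_rejects \<alpha> K T x g \<longleftrightarrow>
    nat \<lceil>(1 - \<alpha>) * real (K + 1)\<rceil> \<le> card {j \<in> {1..K}. T (perm_act (g j) x) < T x}"
proof -
  let ?xs = "T x # map (\<lambda>j. T (perm_act (g j) x)) [1..<K + 1]"
  have "length (filter (\<lambda>y. y < T x) ?xs) =
      length (filter (\<lambda>j. T (perm_act (g j) x) < T x) [1..<K + 1])"
    by (simp add: filter_map comp_def del: upt_Suc)
  also have "\<dots> = card (set (filter (\<lambda>j. T (perm_act (g j) x) < T x) [1..<K + 1]))"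
    by (rule distinct_card[symmetric]) simp
  also have "set (filter (\<lambda>j. T (perm_act (g j) x) < T x) [1..<K + 1]) =
      {j \<in> {1..K}. T (perm_act (g j) x) < T x}"
    by auto
  finally have count: "length (filter (\<lambda>y. y < T x) ?xs) = card {j \<in> {1..K}. T (perm_act (g j) x) < T x}" .
  have "length ?xs = K + 1" by (simp del: upt_Suc)
  then have "nat \<lceil>(1 - \<alpha>) * real (K + 1)\<rceil> \<le> length ?xs"
    using critical_index_le[OF assms] by linarith
  then show ?thesis
    unfolding randomization_rejects_def count[symmetric] by (rule order_stat_less_iff)
qed

section \<open>Random permutations and measurability of rejection\<close>

lemma space_random_perms: "space (random_perms K N) = {1..K} \<rightarrow>\<^sub>E {g. g permutes {1..N}}"
  by (simp add: random_perms_def space_PiM space_uniform_count_measure)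

lemma prob_space_uniform_perms: "prob_space (uniform_count_measure {g. g permutes {1..N::nat}})"
  by (intro prob_space_uniform_count_measure finite_permutations) (auto intro: permutes_id)

lemma prob_space_random_perms: "prob_space (random_perms K N)"
  unfolding random_perms_def by (intro prob_space_PiM prob_space_uniform_perms)

lemma measurable_random_perms_component:
  assumes "j \<in> {1..K}"
  shows "(\<lambda>g. g j) \<in> random_perms K N \<rightarrow>\<^sub>M count_space {g. g permutes {1..N}}"
proof -
  have "(\<lambda>g. g j) \<in> random_perms K N \<rightarrow>\<^sub>M uniform_count_measure {g. g permutes {1..N}}"
    unfolding random_perms_def by (rule measurable_component_singleton[OF assms])
  then show ?thesis
    by (simp only: measurable_cong_sets[OF refl sets_uniform_count_measure_count_space])
qed

lemma sets_randomization_rejects: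
  assumes N: "is_norm p N" and \<alpha>: "1 / real (K + 1) \<le> \<alpha>"
  shows "{\<omega> \<in> space (sample_law p f n n' \<mu> \<mu>' \<Otimes>\<^sub>M random_perms K (n + n')).
      randomization_rejects \<alpha> K (mean_diff_stat p N n n') (fst \<omega>) (snd \<omega>)}
    \<in> sets (sample_law p f n n' \<mu> \<mu>' \<Otimes>\<^sub>M random_perms K (n + n'))"
proof -
  let ?M = "sample_law p f n n' \<mu> \<mu>'" and ?R = "random_perms K (n + n')"
  let ?T = "mean_diff_stat p N n n'" and ?G = "{g. g permutes {1..n + n'}}"
  have fixed: "(\<lambda>\<omega>. ?T (perm_act h (fst \<omega>))) \<in> borel_measurable (?M \<Otimes>\<^sub>M ?R)"
    if "h \<in> ?G" for h
  proof (rule measurable_compose[OF measurable_fst])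
    show "(\<lambda>x. ?T (perm_act h x)) \<in> borel_measurable ?M"
      using measurable_mean_diff_stat_perm[OF N, of h n n'] that
      by (simp only: mem_Collect_eq measurable_cong_sets[OF sets_sample_law refl])
  qed
  \<comment> \<open>A random permutation takes finitely many values, and for each fixed value the
    statistic is measurable.\<close>
  have perm: "(\<lambda>\<omega>. ?T (perm_act (snd \<omega> j) (fst \<omega>))) \<in> borel_measurable (?M \<Otimes>\<^sub>M ?R)"
    if "j \<in> {1..K}" for j
  proof (rule measurable_compose_countable'[where I = ?G and g = "\<lambda>\<omega>. snd \<omega> j"
        and f = "\<lambda>h \<omega>. ?T (perm_act h (fst \<omega>))"])
    show "(\<lambda>\<omega>. snd \<omega> j) \<in> ?M \<Otimes>\<^sub>M ?R \<rightarrow>\<^sub>M count_space ?G"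
      by (rule measurable_compose[OF measurable_snd measurable_random_perms_component[OF that]])
  qed (auto intro: fixed countable_finite finite_permutations)
  have id: "(\<lambda>\<omega>. ?T (fst \<omega>)) \<in> borel_measurable (?M \<Otimes>\<^sub>M ?R)"
    using fixed[of id] by (simp add: permutes_id)
  have sets: "{\<omega> \<in> space (?M \<Otimes>\<^sub>M ?R). j \<in> {j \<in> {1..K}. ?T (perm_act (snd \<omega> j) (fst \<omega>)) < ?T (fst \<omega>)}}
      \<in> sets (?M \<Otimes>\<^sub>M ?R)" for j
  \<comment> \<open>Measurability of the cardinality asks for the membership event of every natural
    number; outside \<open>{1..K}\<close> that event is empty.\<close>
  proof (cases "j \<in> {1..K}")
    case True
    show ?thesis
      using borel_measurable_less[OF perm[OF True] id] by (simp only: mem_Collect_eq True simp_thms)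
  next
    case False
    then show ?thesis by (simp only: mem_Collect_eq simp_thms empty_def[symmetric]) simp
  qed
  have card: "(\<lambda>\<omega>. card {j \<in> {1..K}. ?T (perm_act (snd \<omega> j) (fst \<omega>)) < ?T (fst \<omega>)})
      \<in> ?M \<Otimes>\<^sub>M ?R \<rightarrow>\<^sub>M count_space UNIV"
    by (rule measurable_card) (rule sets)
  show ?thesis
    unfolding randomization_rejects_iff[OF \<alpha>]
    using measurable_sets[OF card, of "{nat \<lceil>(1 - \<alpha>) * real (K + 1)\<rceil>..}"]
    by (rule back_subst[of "\<lambda>A. A \<in> sets (?M \<Otimes>\<^sub>M ?R)"]) auto
qed

section \<open>Bounds on the rejection probability\<close>

text \<open>The deterministic core. With \<delta> the norm of \<open>vdiff p \<mu>' \<mu>\<close>,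
  the observed statistic is at least \<open>\<delta> - t\<close> and each permuted one at most
  \<open>c * \<delta> + t\<close>; \<open>sep\<close> says precisely that the second bound lies
  below the first.\<close>

lemma rejects_shifted_sample:
  assumes N: "is_norm p N" and \<alpha>: "1 / real (K + 1) \<le> \<alpha>" and n: "n \<ge> 1" "n' \<ge> 1"
    and x: "x = (\<lambda>i\<in>{1..n + n'}. vadd p (if i \<le> n then \<mu> else \<mu>') (\<epsilon> i))"
    and sep: "2 * t < (1 - c) * N (vdiff p \<mu>' \<mu>)"
    and g: "\<And>j. j \<in> {1..K} \<Longrightarrow> g j permutes {1..n + n'}"
      "\<And>j. j \<in> {1..K} \<Longrightarrow> \<bar>contrast n n' (g j)\<bar> \<le> c"
    and \<epsilon>: "mean_diff_stat p N n n' \<epsilon> \<le> t"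
      "\<And>j. j \<in> {1..K} \<Longrightarrow> mean_diff_stat p N n n' (perm_act (g j) \<epsilon>) \<le> t"
  shows "randomization_rejects \<alpha> K (mean_diff_stat p N n n') x g"
proof -
  let ?T = "mean_diff_stat p N n n'" and ?\<delta> = "N (vdiff p \<mu>' \<mu>)"
  have less: "?T (perm_act (g j) x) < ?T x" if j: "j \<in> {1..K}" for j
  proof -
    have "\<bar>?T x - ?\<delta>\<bar> \<le> t"
      using mean_diff_stat_shift[OF N n permutes_id x] \<epsilon>(1) contrast_id[of n n'] n
      by (simp add: order_trans)
    moreover have "\<bar>?T (perm_act (g j) x) - \<bar>contrast n n' (g j)\<bar> * ?\<delta>\<bar> \<le> t"
      using mean_diff_stat_shift[OF N n g(1)[OF j] x] \<epsilon>(2)[OF j] by (rule order_trans)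
    moreover have "\<bar>contrast n n' (g j)\<bar> * ?\<delta> \<le> c * ?\<delta>"
      using g(2)[OF j] norm_nonneg[OF N, of "vdiff p \<mu>' \<mu>"] by (simp add: mult_right_mono)
    moreover have "2 * t < ?\<delta> - c * ?\<delta>" using sep by (simp add: left_diff_distrib)
    ultimately show ?thesis by linarith
  qed
  have "{j \<in> {1..K}. ?T (perm_act (g j) x) < ?T x} = {1..K}" using less by blast
  then show ?thesis
    unfolding randomization_rejects_iff[OF \<alpha>] using critical_index_le[OF \<alpha>] by simp
qed

text \<open>Failure to reject forces a large noise statistic in one of \<open>K + 1\<close>
  arrangements. By exchangeability these have equal probabilities, and a union bound
  applies.\<close>

lemma prob_not_rejects_fixed_perms:
  assumes f: "location_family p f" and N: "is_norm p N" and \<alpha>: "1 / real (K + 1) \<le> \<alpha>"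
    and n: "n \<ge> 1" "n' \<ge> 1" and \<mu>: "\<mu> \<in> Rn p" "\<mu>' \<in> Rn p"
    and sep: "2 * t < (1 - c) * N (vdiff p \<mu>' \<mu>)"
    and g: "\<And>j. j \<in> {1..K} \<Longrightarrow> g j permutes {1..n + n'}"
      "\<And>j. j \<in> {1..K} \<Longrightarrow> \<bar>contrast n n' (g j)\<bar> \<le> c"
    and sets: "{x \<in> space (sample_law p f n n' \<mu> \<mu>'). \<not> randomization_rejects \<alpha> K (mean_diff_stat p N n n') x g}
      \<in> sets (sample_law p f n n' \<mu> \<mu>')"
  shows "\<P>(x in sample_law p f n n' \<mu> \<mu>'. \<not> randomization_rejects \<alpha> K (mean_diff_stat p N n n') x g)
    \<le> real (K + 1) * (1 - \<P>(\<epsilon> in sample_law p f n n' (vzero p) (vzero p). mean_diff_stat p N n n' \<epsilon> \<le> t))"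
proof -
  let ?M = "sample_law p f n n' \<mu> \<mu>'" and ?P = "sample_law p f n n' (vzero p) (vzero p)"
  let ?T = "mean_diff_stat p N n n'" and ?I = "{1..n + n'}"
  let ?L = "Pi\<^sub>M ?I (\<lambda>_. lborel_Rn p)"
  let ?s = "\<lambda>\<epsilon>. \<lambda>i\<in>?I. vadd p (if i \<le> n then \<mu> else \<mu>') (\<epsilon> i)"
  \<comment> \<open>Index 0 stands for the observed arrangement.\<close>
  let ?h = "\<lambda>j. if j = 0 then id else g j"
  let ?B = "\<lambda>j. {\<epsilon> \<in> space ?P. \<not> ?T (perm_act (?h j) \<epsilon>) \<le> t}"
  interpret P: prob_space ?P by (rule prob_space_sample_law[OF f]) simp_all
  have h: "?h j permutes ?I" if "j \<in> {0..K}" for j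
    using g(1)[of j] that by (auto intro: permutes_id)
  have meas: "?s \<in> ?P \<rightarrow>\<^sub>M ?L"
    unfolding measurable_cong_sets[OF sets_sample_law refl]
    by (rule measurable_restrict, rule measurable_compose[OF _ measurable_vadd],
        rule measurable_component_singleton)
  have T: "(\<lambda>\<epsilon>. ?T (perm_act (?h j) \<epsilon>)) \<in> borel_measurable ?P" if "j \<in> {0..K}" for j
    unfolding measurable_cong_sets[OF sets_sample_law refl]
    by (rule measurable_mean_diff_stat_perm[OF N h[OF that]])
  have good: "{\<epsilon> \<in> space ?P. ?T (perm_act (?h j) \<epsilon>) \<le> t} \<in> sets ?P" if "j \<in> {0..K}" for j
    by (rule borel_measurable_le[OF T[OF that] borel_measurable_const])
  have B: "?B j \<in> sets ?P" if "j \<in> {0..K}" for j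
    using sets.compl_sets[OF good[OF that]] by (rule back_subst[of "\<lambda>A. A \<in> sets ?P"]) auto
  have probB: "P.prob (?B j) = 1 - \<P>(\<epsilon> in ?P. ?T \<epsilon> \<le> t)" if "j \<in> {0..K}" for j
    using P.prob_neg[OF good[OF that]] sample_law_exchangeable[OF f N h[OF that], of t] by simp
  let ?A = "{x \<in> space ?M. \<not> randomization_rejects \<alpha> K ?T x g}"
  have "measure ?M ?A = measure (distr ?P ?L ?s) ?A"
    by (simp only: sample_law_shift[OF f \<mu>, symmetric])
  also have "\<dots> = P.prob (?s -` ?A \<inter> space ?P)"
    using sets by (intro measure_distr[OF meas]) (simp only: sets_sample_law)
  also have "\<dots> \<le> P.prob (\<Union>j\<in>{0..K}. ?B j)"
  proof (rule P.finite_measure_mono)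
    show "?s -` ?A \<inter> space ?P \<subseteq> (\<Union>j\<in>{0..K}. ?B j)"
    proof (rule subsetI, rule ccontr)
      fix \<epsilon> assume \<epsilon>: "\<epsilon> \<in> ?s -` ?A \<inter> space ?P" "\<epsilon> \<notin> (\<Union>j\<in>{0..K}. ?B j)"
      then have *: "?T (perm_act (?h j) \<epsilon>) \<le> t" if "j \<in> {0..K}" for j
        using that by blast
      have "randomization_rejects \<alpha> K ?T (?s \<epsilon>) g"
      proof (rule rejects_shifted_sample[OF N \<alpha> n refl sep g])
        show "?T \<epsilon> \<le> t" using *[of 0] by simp
        show "?T (perm_act (g j) \<epsilon>) \<le> t" if "j \<in> {1..K}" for j
          using *[of j] that by simp
      qed
      then show False using \<epsilon>(1) by simp
    qed
    show "(\<Union>j\<in>{0..K}. ?B j) \<in> sets ?P" using B by blast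
  qed
  also have "\<dots> \<le> (\<Sum>j\<in>{0..K}. P.prob (?B j))"
    using B by (intro P.finite_measure_subadditive_finite) auto
  also have "\<dots> = (\<Sum>j\<in>{0..K}. 1 - \<P>(\<epsilon> in ?P. ?T \<epsilon> \<le> t))"
    by (rule sum.cong[OF refl probB])
  also have "\<dots> = real (K + 1) * (1 - \<P>(\<epsilon> in ?P. ?T \<epsilon> \<le> t))"
    by simp
  finally show ?thesis .
qed

text \<open>Chebyshev's inequality, carried out by counting permutations.\<close>

lemma prob_large_contrast:
  assumes n: "n \<ge> 1" "n' \<ge> 1" and c: "c > 0"
  shows "measure (uniform_count_measure {g. g permutes {1..n + n'}})
      {g. g permutes {1..n + n'} \<and> c < \<bar>contrast n n' g\<bar>} \<le> 1 / (c\<^sup>2 * (real (n + n') - 1))"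
proof -
  let ?G = "{g. g permutes {1..n + n'}}" and ?X = "{g. g permutes {1..n + n'} \<and> c < \<bar>contrast n n' g\<bar>}"
  have fin: "finite ?G" by (rule finite_permutations) simp
  have sub: "?X \<subseteq> ?G" by blast
  have "real (card ?X) * c\<^sup>2 = (\<Sum>g\<in>?X. c\<^sup>2)" by simp
  also have "\<dots> \<le> (\<Sum>g\<in>?X. (contrast n n' g)\<^sup>2)"
    using c by (intro sum_mono) (auto simp: abs_le_square_iff[symmetric])
  also have "\<dots> \<le> (\<Sum>g\<in>?G. (contrast n n' g)\<^sup>2)"
    using fin sub by (intro sum_mono2) auto
  also have "\<dots> = fact (n + n') / (real (n + n') - 1)"
    by (rule contrast_second_moment[OF n])
  finally have le: "real (card ?X) * c\<^sup>2 \<le> fact (n + n') / (real (n + n') - 1)" .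
  define D where "D = c\<^sup>2 * (real (n + n') - 1)"
  have pos: "real (n + n') - 1 > 0" using n by linarith
  then have "D > 0" using c by (simp add: D_def)
  moreover have "real (card ?X) * D \<le> fact (n + n')"
    using le unfolding D_def pos_le_divide_eq[OF pos] by (simp only: mult.assoc)
  ultimately have "real (card ?X) / fact (n + n') \<le> 1 / D"
    by (simp add: field_simps)
  moreover have "card ?G = fact (n + n')" by (rule card_permutations) simp_all
  ultimately show ?thesis
    using measure_uniform_count_measure[OF fin sub] by (simp add: D_def)
qed

text \<open>Integrate over the permutations last. If all contrasts are at most \<open>c\<close>, the
  bound for fixed permutations applies; otherwise the trivial bound 1 is used, on an event of
  probability at most \<open>K\<close> times the Chebyshev bound.\<close>

lemma rejection_prob_ge:
  assumes f: "location_family p f" and N: "is_norm p N" and \<alpha>: "1 / real (K + 1) \<le> \<alpha>"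
    and n: "n \<ge> 1" "n' \<ge> 1" and \<mu>: "\<mu> \<in> Rn p" "\<mu>' \<in> Rn p"
    and c: "c > 0" and sep: "2 * t < (1 - c) * N (vdiff p \<mu>' \<mu>)"
  shows "rejection_prob \<alpha> K p N f n n' \<mu> \<mu>' \<ge>
    1 - real (K + 1) * (1 - \<P>(\<epsilon> in sample_law p f n n' (vzero p) (vzero p). mean_diff_stat p N n n' \<epsilon> \<le> t))
      - real K * (1 / (c\<^sup>2 * (real (n + n') - 1)))"
proof -
  let ?M = "sample_law p f n n' \<mu> \<mu>'" and ?R = "random_perms K (n + n')"
  let ?T = "mean_diff_stat p N n n'" and ?G = "{g. g permutes {1..n + n'}}"
  define q where "q = \<P>(\<epsilon> in sample_law p f n n' (vzero p) (vzero p). ?T \<epsilon> \<le> t)"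
  define r where "r = 1 / (c\<^sup>2 * (real (n + n') - 1))"
  define E where "E = {\<omega> \<in> space (?M \<Otimes>\<^sub>M ?R). randomization_rejects \<alpha> K ?T (fst \<omega>) (snd \<omega>)}"
  define bad where "bad j = {g \<in> space ?R. c < \<bar>contrast n n' (g j)\<bar>}" for j
  define Bad where "Bad = (\<Union>j\<in>{1..K}. bad j)"
  interpret P: prob_space "sample_law p f n n' (vzero p) (vzero p)"
    by (rule prob_space_sample_law[OF f]) simp_all
  interpret M: prob_space ?M by (rule prob_space_sample_law[OF f \<mu>])
  interpret R: prob_space ?R by (rule prob_space_random_perms)
  interpret MR: pair_prob_space ?M ?R ..
  have q: "q \<le> 1" by (simp add: q_def)
  have E: "E \<in> sets (?M \<Otimes>\<^sub>M ?R)"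
    unfolding E_def by (rule sets_randomization_rejects[OF N \<alpha>])
  have bad: "bad j \<in> sets ?R \<and> R.prob (bad j) \<le> r" if j: "j \<in> {1..K}" for j
  proof -
    let ?X = "{g. g permutes {1..n + n'} \<and> c < \<bar>contrast n n' g\<bar>}"
    have X: "?X \<in> sets (uniform_count_measure ?G)" by (auto simp: sets_uniform_count_measure)
    have comp: "(\<lambda>g. g j) \<in> ?R \<rightarrow>\<^sub>M uniform_count_measure ?G"
      unfolding random_perms_def by (rule measurable_component_singleton[OF j])
    have eq: "(\<lambda>g. g j) -` ?X \<inter> space ?R = bad j"
      using measurable_space[OF comp] by (auto simp: bad_def space_uniform_count_measure)
    \<comment> \<open>Each single permutation of the random tuple is uniform.\<close>
    have "distr ?R (uniform_count_measure ?G) (\<lambda>g. g j) = uniform_count_measure ?G"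
      unfolding random_perms_def
      by (rule distr_PiM_component[OF prob_space_uniform_perms j])
    then have "R.prob (bad j) = measure (uniform_count_measure ?G) ?X"
      using measure_distr[OF comp X] eq by simp
    then show ?thesis
      using prob_large_contrast[OF n c] measurable_sets[OF comp X] eq by (simp add: r_def)
  qed
  have Bad: "Bad \<in> sets ?R" using bad unfolding Bad_def by blast
  have "R.prob Bad \<le> (\<Sum>j\<in>{1..K}. R.prob (bad j))"
    unfolding Bad_def using bad by (intro R.finite_measure_subadditive_finite) auto
  also have "\<dots> \<le> (\<Sum>j\<in>{1..K}. r)" using bad by (intro sum_mono) blast
  finally have probBad: "R.prob Bad \<le> real K * r" by simp
  have compl: "space (?M \<Otimes>\<^sub>M ?R) - E \<in> sets (?M \<Otimes>\<^sub>M ?R)" using E by (rule sets.compl_sets)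
  \<comment> \<open>The indicator absorbs the sections at bad permutations, so one bound can be
    integrated over all \<open>g\<close>.\<close>
  have section_le: "emeasure ?M ((\<lambda>x. (x, g)) -` (space (?M \<Otimes>\<^sub>M ?R) - E)) \<le>
      ennreal (real (K + 1) * (1 - q)) + indicator Bad g" if g: "g \<in> space ?R" for g
  proof (cases "g \<in> Bad")
    case True
    then show ?thesis
      using M.emeasure_le_1[of "(\<lambda>x. (x, g)) -` (space (?M \<Otimes>\<^sub>M ?R) - E)"]
      by (simp add: add_increasing)
  next
    case False
    let ?A = "{x \<in> space ?M. \<not> randomization_rejects \<alpha> K ?T x g}"
    have eq: "(\<lambda>x. (x, g)) -` (space (?M \<Otimes>\<^sub>M ?R) - E) = ?A"
      using g by (auto simp: E_def space_pair_measure)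
    \<comment> \<open>Sections of a measurable event are measurable, which provides the
      measurability required at fixed permutations.\<close>
    then have sets: "?A \<in> sets ?M" using sets_Pair2[OF compl, of g] by simp
    have "M.prob ?A \<le> real (K + 1) * (1 - q)"
      unfolding q_def
    proof (rule prob_not_rejects_fixed_perms[OF f N \<alpha> n \<mu> sep _ _ sets])
      show "g j permutes {1..n + n'}" if "j \<in> {1..K}" for j
        using g that by (auto simp: space_random_perms PiE_iff)
      show "\<bar>contrast n n' (g j)\<bar> \<le> c" if "j \<in> {1..K}" for j
        using False g that by (force simp: Bad_def bad_def)
    qed
    then show ?thesis
      using False unfolding eq by (simp add: M.emeasure_eq_measure ennreal_leI)
  qed
  have "emeasure (?M \<Otimes>\<^sub>M ?R) (space (?M \<Otimes>\<^sub>M ?R) - E) =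
      (\<integral>\<^sup>+g. emeasure ?M ((\<lambda>x. (x, g)) -` (space (?M \<Otimes>\<^sub>M ?R) - E)) \<partial>?R)"
    by (rule MR.emeasure_pair_measure_alt2[OF compl])
  also have "\<dots> \<le> (\<integral>\<^sup>+g. ennreal (real (K + 1) * (1 - q)) + indicator Bad g \<partial>?R)"
    by (rule nn_integral_mono[OF section_le])
  also have "\<dots> = ennreal (real (K + 1) * (1 - q)) + emeasure ?R Bad"
    using Bad by (subst nn_integral_add) (auto simp: R.emeasure_space_1)
  also have "\<dots> = ennreal (real (K + 1) * (1 - q) + R.prob Bad)"
    using q by (simp add: R.emeasure_eq_measure ennreal_plus)
  finally have "MR.prob (space (?M \<Otimes>\<^sub>M ?R) - E) \<le> real (K + 1) * (1 - q) + R.prob Bad"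
    using q unfolding MR.emeasure_eq_measure by (subst (asm) ennreal_le_iff) auto
  then have "1 - MR.prob E \<le> real (K + 1) * (1 - q) + real K * r"
    using probBad MR.prob_compl[OF E] by simp
  then show ?thesis
    by (simp add: rejection_prob_def E_def q_def r_def)
qed

section \<open>Passage to the limit along the experiments\<close>

theorem proposition3p7:
  fixes p n n' :: "nat \<Rightarrow> nat"
    and f :: "nat \<Rightarrow> (nat \<Rightarrow> real) \<Rightarrow> (nat \<Rightarrow> real) \<Rightarrow> real"
    and N :: "nat \<Rightarrow> (nat \<Rightarrow> real) \<Rightarrow> real"
    and \<Theta> :: "nat \<Rightarrow> ((nat \<Rightarrow> real) \<times> (nat \<Rightarrow> real)) set"
    and t :: "nat \<Rightarrow> real"
    and \<alpha> :: real and K :: nat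
  assumes level: "0 < \<alpha>" "\<alpha> \<le> 1"
    and K: "K \<ge> 1" "1 / real (K + 1) \<le> \<alpha>"
    and sizes: "\<And>m. m \<ge> 1 \<Longrightarrow> n m \<ge> 1 \<and> n' m \<ge> 1"
    and family: "\<And>m. m \<ge> 1 \<Longrightarrow> location_family (p m) (f m)"
    and norm: "\<And>m. m \<ge> 1 \<Longrightarrow> is_norm (p m) (N m)"
    and alternatives: "\<And>m. m \<ge> 1 \<Longrightarrow> \<Theta> m \<subseteq> Rn (p m) \<times> Rn (p m)"
    and total_size: "filterlim (\<lambda>m. n m + n' m) at_top sequentially"
    and t_pos: "\<And>m. m \<ge> 1 \<Longrightarrow> t m > 0"
    and noise: "(\<lambda>m. \<P>(\<epsilon> in sample_law (p m) (f m) (n m) (n' m) (vzero (p m)) (vzero (p m)).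
        N m (vdiff (p m) (last_mean (p m) (n m) (n' m) \<epsilon>) (first_mean (p m) (n m) \<epsilon>)) \<le> t m))
      \<longlonglongrightarrow> 1"
    and separation: "\<And>\<mu> \<mu>'. (\<And>m. m \<ge> 1 \<Longrightarrow> (\<mu> m, \<mu>' m) \<in> \<Theta> m) \<Longrightarrow>
        liminf (\<lambda>m. ereal (N m (vdiff (p m) (\<mu>' m) (\<mu> m)) / t m)) > 2"
  shows "consistent_against
    (\<lambda>m (\<mu>, \<mu>'). rejection_prob \<alpha> K (p m) (N m) (f m) (n m) (n' m) \<mu> \<mu>') \<Theta>"
  unfolding consistent_against_def
proof (intro allI impI)
  fix \<theta> assume \<theta>: "\<forall>m\<ge>1. \<theta> m \<in> \<Theta> m"
  define \<mu> where "\<mu> m = fst (\<theta> m)" for m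
  define \<mu>' where "\<mu>' m = snd (\<theta> m)" for m
  define \<delta> where "\<delta> m = N m (vdiff (p m) (\<mu>' m) (\<mu> m))" for m
  define \<beta> where "\<beta> m = rejection_prob \<alpha> K (p m) (N m) (f m) (n m) (n' m) (\<mu> m) (\<mu>' m)" for m
  define q where "q m = \<P>(\<epsilon> in sample_law (p m) (f m) (n m) (n' m) (vzero (p m)) (vzero (p m)).
        N m (vdiff (p m) (last_mean (p m) (n m) (n' m) \<epsilon>) (first_mean (p m) (n m) \<epsilon>)) \<le> t m)" for m
  have "2 < liminf (\<lambda>m. ereal (\<delta> m / t m))"
    unfolding \<delta>_def by (rule separation) (use \<theta> in \<open>simp add: \<mu>_def \<mu>'_def\<close>)
  \<comment> \<open>A real level strictly between 2 and the limit inferior, which may be infinite;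
    it leaves a margin that does not depend on \<open>m\<close>.\<close>
  then obtain y where y: "2 < ereal y" "ereal y < liminf (\<lambda>m. ereal (\<delta> m / t m))"
    using ereal_dense2 by blast
  have y2: "y > 2" using y(1) by simp
  \<comment> \<open>Chosen so that \<open>(1 - c) * \<delta> m\<close> is
    \<open>2 * \<delta> m / y\<close>, which exceeds \<open>2 * t m\<close> as soon as
    \<open>\<delta> m / t m > y\<close>.\<close>
  define c where "c = 1 - 2 / y"
  have c: "c > 0" using y2 by (simp add: c_def field_simps)
  have "eventually (\<lambda>m. y < \<delta> m / t m) sequentially"
    using less_LiminfD[OF y(2)] by simp
  moreover have "eventually (\<lambda>m. m \<ge> 1) sequentially" by (rule eventually_ge_at_top)
  ultimately have lower: "eventually (\<lambda>m. 1 - real (K + 1) * (1 - q m)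
      - real K * (1 / (c\<^sup>2 * (real (n m + n' m) - 1))) \<le> \<beta> m) sequentially"
  proof eventually_elim
    case (elim m)
    then have m: "m \<ge> 1" by simp
    have "y * t m < \<delta> m" using elim(1) t_pos[OF m] by (simp add: field_simps)
    then have "2 * t m < (1 - c) * \<delta> m" using y2 by (simp add: c_def field_simps)
    moreover have "\<mu> m \<in> Rn (p m)" "\<mu>' m \<in> Rn (p m)"
      using \<theta> m alternatives[OF m] by (auto simp: \<mu>_def \<mu>'_def mem_Times_iff dest!: subsetD)
    \<comment> \<open>The noise condition subtracts the first mean from the last and the statistic
      does the opposite; the symmetry of the norm reconciles them.\<close>
    ultimately show ?case
      using rejection_prob_ge[OF family[OF m] norm[OF m] K(2), of "n m" "n' m" "\<mu> m" "\<mu>' m" c "t m"]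
        sizes[OF m] c
      unfolding \<beta>_def \<delta>_def q_def mean_diff_stat_def
        norm_vdiff_commute[OF norm[OF m], of "last_mean (p m) (n m) (n' m) _"] by blast
  qed
  have upper: "eventually (\<lambda>m. \<beta> m \<le> 1) sequentially"
    using eventually_ge_at_top[of 1]
  proof eventually_elim
    case (elim m)
    have "\<mu> m \<in> Rn (p m)" "\<mu>' m \<in> Rn (p m)"
      using \<theta> elim alternatives[OF elim] by (auto simp: \<mu>_def \<mu>'_def mem_Times_iff dest!: subsetD)
    then interpret pair_prob_space "sample_law (p m) (f m) (n m) (n' m) (\<mu> m) (\<mu>' m)" "random_perms K (n m + n' m)"
      by (intro pair_prob_space.intro pair_sigma_finite.intro prob_space_imp_sigma_finite
          prob_space_sample_law[OF family[OF elim]] prob_space_random_perms)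
    show ?case unfolding \<beta>_def rejection_prob_def by (rule prob_le_1)
  qed
  have size: "filterlim (\<lambda>m. real (n m + n' m)) at_top sequentially"
    by (rule filterlim_compose[OF filterlim_real_sequentially total_size])
  \<comment> \<open>Here \<open>c\<close> is fixed and positive, so the denominator grows with the
    total sample size.\<close>
  have "(\<lambda>m. 1 / (c\<^sup>2 * (real (n m + n' m) - 1))) \<longlonglongrightarrow> 0"
    using c by (intro tendsto_divide_0[OF tendsto_const] filterlim_at_top_imp_at_infinity
        filterlim_tendsto_pos_mult_at_top[OF tendsto_const])
      (auto intro!: filterlim_tendsto_add_at_top[OF tendsto_const size, of "-1", simplified])
  then have "(\<lambda>m. 1 - real (K + 1) * (1 - q m) - real K * (1 / (c\<^sup>2 * (real (n m + n' m) - 1))))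
      \<longlonglongrightarrow> 1 - real (K + 1) * (1 - 1) - real K * 0"
    using noise unfolding q_def by (intro tendsto_intros)
  \<comment> \<open>The rejection probability is squeezed between a lower bound tending to 1 and the
    constant 1.\<close>
  then have "\<beta> \<longlonglongrightarrow> 1"
    by (intro tendsto_sandwich[OF lower upper _ tendsto_const]) simp
  then show "(\<lambda>m. (case \<theta> m of (\<mu>, \<mu>') \<Rightarrow> rejection_prob \<alpha> K (p m) (N m) (f m) (n m) (n' m) \<mu> \<mu>')) \<longlonglongrightarrow> 1"
    by (simp add: \<beta>_def[abs_def] \<mu>_def \<mu>'_def case_prod_unfold)
qed

end
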